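(* Let $P$ be a finite partially ordered set and let $K$ be a field. Then the toric ring $K[\mathcal{C}(P)]$ of the chain polytope $\mathcal{C}(P)$ of $P$ is an algebra with straightening laws on a finite distributive lattice over $K$; that is, there exist a finite distributive lattice $L$ and an injection $\varphi : L \to K[\mathcal{C}(P)]$ with respect to which $K[\mathcal{C}(P)]$ is an algebra with straightening laws on $L$ over $K$.
   Context: Let $P = \{x_1,\ldots,x_d\}$ be a finite poset. An antichain of $P$ is a subset $A \subset P$ whose distinct elements are pairwise incomparable (the empty set is an antichain). The chain polytope $\mathcal{C}(P) \subset \mathbb{R}^d$ is the set of all $(a_1,\ldots,a_d) \in \mathbb{R}^d$ such that $a_i \geq 0$ for all $1 \le i \le d$ and $a_{i_1} + \cdots + a_{i_k} \leq 1$ for every maximal chain $x_{i_1} < \cdots < x_{i_k}$ of $P$. Its vertices are the vectors $\rho(A) = \sum_{x_i \in A} \mathbf{e}_i$ with $A$ an antichain of $P$, where $\mathbf{e}_1,\ldots,\mathbf{e}_d$ are the unit coordinate vectors. Toric ring: let $S = K[x_1,\ldots,x_d,t]$ be the polynomial ring over the field $K$. For $W \subset P$ put $x(W) = \prod_{x_i \in W} x_i \in S$, with $x(\emptyset) = 1$. The toric ring $K[\mathcal{C}(P)]$ is the $K$-subalgebra of $S$ generated by the monomials $t \cdot x(A)$ with $A$ ranging over all antichains of $P$. It is regarded as a graded $K$-algebra by setting $\deg(t \cdot x(A)) = 1$ for every antichain $A$ (i.e. graded by the exponent of $t$). Algebra with straightening laws: let $R = \bigoplus_{n \geq 0} R_n$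 be a graded algebra over a field $R_0 = K$, and let $Q$ be a poset with an injection $\varphi : Q \to R$ such that $\varphi(\alpha)$ is homogeneous of degree $\geq 1$ for every $\alpha \in Q$. A standard monomial of $R$ is a finite product $\varphi(\alpha_1)\varphi(\alpha_2)\cdots$ with $\alpha_1 \leq \alpha_2 \leq \cdots$ in $Q$ (the empty product $1$ included). Then $R$ is an algebra with straightening laws on $Q$ over $K$ (with respect to $\varphi$) if: (i) the set of standard monomials is a basis of $R$ as a $K$-vector space (distinct multichains giving distinct basis elements); (ii) if $\alpha, \beta \in Q$ are incomparable and $\varphi(\alpha)\varphi(\beta) = \sum_i r_i\, \varphi(\gamma_{i_1})\varphi(\gamma_{i_2})\cdots$, with $0 \neq r_i \in K$ and $\gamma_{i_1} \leq \gamma_{i_2} \leq \cdots$, is the unique expression of $\varphi(\alpha)\varphi(\beta)$ as a linear combination of distinct standard monomials, then $\gamma_{i_1} \leq \alpha$ and $\gamma_{i_1} \leq \beta$ for every $i$. *)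

theory Defs
  imports "HOL-Library.Poly_Mapping" "HOL-Algebra.Lattice" "HOL.Hull" "HOL.Vector_Spaces"
begin

section \<open>Graded algebras and algebras with straightening laws\<close>

locale comm_algebra = vector_space scale
  for scale :: "'k::field \<Rightarrow> 'r::comm_ring_1 \<Rightarrow> 'r"  (infixr \<open>*s\<close> 75) +
  assumes scale_mult_left: "(c *s x) * y = c *s (x * y)"
begin

definition subalgebra :: "'r set \<Rightarrow> bool" where
  "subalgebra B \<longleftrightarrow> subspace B \<and> 1 \<in> B \<and> (\<forall>x\<in>B. \<forall>y\<in>B. x * y \<in> B)"

end

text \<open>
  A graded algebra with \<open>R\<^sub>0 = K\<close> is given as a subalgebra \<open>R\<close> of an ambient commutative algebra,
  with homogeneous components \<open>G n\<close>. The assumption \<open>direct_sum\<close> says that \<open>R\<close> is the internal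
  direct sum of the \<open>G n\<close>.
\<close>

locale graded_algebra = comm_algebra scale
  for scale :: "'k::field \<Rightarrow> 'r::comm_ring_1 \<Rightarrow> 'r"  (infixr \<open>*s\<close> 75) +
  fixes R :: "'r set" and G :: "nat \<Rightarrow> 'r set"
  assumes subalgebra_R: "subalgebra R"
    and component_subset: "G n \<subseteq> R"
    and component_subspace: "subspace (G n)"
    and component_mult: "\<lbrakk>x \<in> G m; y \<in> G n\<rbrakk> \<Longrightarrow> x * y \<in> G (m + n)"
    and component_0: "G 0 = (\<Union>c. {c *s 1})"
    and direct_sum:
      "x \<in> R \<Longrightarrow> \<exists>!f. (\<forall>n. f n \<in> G n) \<and> finite {n. f n \<noteq> 0} \<and> x = (\<Sum>n | f n \<noteq> 0. f n)"

text \<open>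
  By antisymmetry a finite multichain has exactly one representation as a weakly increasing list.
\<close>

definition multichains :: "('q, 'm) gorder_scheme \<Rightarrow> 'q list set" where
  "multichains Q =
    {xs. set xs \<subseteq> carrier Q \<and> sorted_wrt (\<lambda>x y. x \<sqsubseteq>\<^bsub>Q\<^esub> y) xs}"

definition standard_monomial :: "('q \<Rightarrow> 'r::comm_monoid_mult) \<Rightarrow> 'q list \<Rightarrow> 'r" where
  "standard_monomial \<phi> xs = prod_list (map \<phi> xs)"

text \<open>
  In \<open>straightening\<close>, \<open>C\<close> is the finite set of multichains occurring with a nonzero coefficient.
  The clause \<open>\<gamma> \<noteq> []\<close> only makes \<open>hd \<gamma>\<close> meaningful: the left-hand side is homogeneous of positive
  degree, so the empty product cannot occur.
\<close>

locale algebra_with_straightening_laws =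
  graded_algebra scale R G + partial_order Q
  for scale :: "'k::field \<Rightarrow> 'r::comm_ring_1 \<Rightarrow> 'r"  (infixr \<open>*s\<close> 75)
    and R :: "'r set" and G :: "nat \<Rightarrow> 'r set"
    and Q :: "('q, 'm) gorder_scheme" (structure) +
  fixes \<phi> :: "'q \<Rightarrow> 'r"
  assumes inj: "inj_on \<phi> (carrier Q)"
    and homogeneous: "\<alpha> \<in> carrier Q \<Longrightarrow> \<exists>n\<ge>1. \<phi> \<alpha> \<in> G n"
    and standard_inj: "inj_on (standard_monomial \<phi>) (multichains Q)"
    and standard_independent: "independent (standard_monomial \<phi> ` multichains Q)"
    and standard_span: "span (standard_monomial \<phi> ` multichains Q) = R"
    and straightening:
      "\<lbrakk>\<alpha> \<in> carrier Q; \<beta> \<in> carrier Q; \<not> \<alpha> \<sqsubseteq> \<beta>; \<not> \<beta> \<sqsubseteq> \<alpha>;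
        finite C; C \<subseteq> multichains Q; \<forall>\<gamma>\<in>C. r \<gamma> \<noteq> 0;
        \<phi> \<alpha> * \<phi> \<beta> = (\<Sum>\<gamma>\<in>C. r \<gamma> *s standard_monomial \<phi> \<gamma>); \<gamma> \<in> C\<rbrakk>
       \<Longrightarrow> \<gamma> \<noteq> [] \<and> hd \<gamma> \<sqsubseteq> \<alpha> \<and> hd \<gamma> \<sqsubseteq> \<beta>"

locale distributive_lattice = lattice L for L (structure) +
  assumes distrib:
    "\<lbrakk>x \<in> carrier L; y \<in> carrier L; z \<in> carrier L\<rbrakk>
      \<Longrightarrow> x \<sqinter> (y \<squnion> z) = (x \<sqinter> y) \<squnion> (x \<sqinter> z)"


section \<open>The toric ring of the chain polytope\<close>

text \<open>
  Polynomials are finitely supported functions from exponent vectors to coefficients, with the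
  convolution product. The ambient ring has a variable \<open>X x\<close> for every \<open>x :: 'a\<close>; if the poset is
  a proper subset of the type, this is larger than the polynomial ring over the elements of the
  poset, which does not affect the subalgebra generated by the monomials below.
\<close>

datatype 'a toric_var = X 'a | T

type_synonym ('a, 'k) toric_poly = "('a toric_var \<Rightarrow>\<^sub>0 nat) \<Rightarrow>\<^sub>0 'k"

definition Var :: "'a toric_var \<Rightarrow> ('a, 'k::comm_semiring_1) toric_poly" where
  "Var v = Poly_Mapping.single (Poly_Mapping.single v 1) 1"

definition poly_scale :: "'k::field \<Rightarrow> ('a, 'k) toric_poly \<Rightarrow> ('a, 'k) toric_poly" where
  "poly_scale c f = Poly_Mapping.single 0 c * f"

interpretation poly: comm_algebra
  "poly_scale :: 'k::field \<Rightarrow> ('a, 'k) toric_poly \<Rightarrow> ('a, 'k) toric_poly"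
proof unfold_locales
  show "poly_scale a (x + y) = poly_scale a x + poly_scale a y"
    for a and x y :: "('a, 'k) toric_poly"
    by (simp add: poly_scale_def distrib_left)
  show "poly_scale (a + b) x = poly_scale a x + poly_scale b x"
    for a b and x :: "('a, 'k) toric_poly"
    by (simp add: poly_scale_def single_add distrib_right)
  show "poly_scale a (poly_scale b x) = poly_scale (a * b) x"
    for a b and x :: "('a, 'k) toric_poly"
    by (simp add: poly_scale_def mult.assoc[symmetric] mult_single)
  show "poly_scale 1 x = x"
    for x :: "('a, 'k) toric_poly"
    by (simp add: poly_scale_def)
  show "poly_scale c x * y = poly_scale c (x * y)"
    for c and x y :: "('a, 'k) toric_poly"
    by (simp add: poly_scale_def mult.assoc)
qed

definition antichains :: "('a, 'm) gorder_scheme \<Rightarrow> 'a set set" where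
  "antichains P =
    {A. A \<subseteq> carrier P \<and> (\<forall>x\<in>A. \<forall>y\<in>A. x \<noteq> y \<longrightarrow> \<not> x \<sqsubseteq>\<^bsub>P\<^esub> y \<and> \<not> y \<sqsubseteq>\<^bsub>P\<^esub> x)}"

definition toric_ring :: "('a, 'm) gorder_scheme \<Rightarrow> ('a, 'k::field) toric_poly set" where
  "toric_ring P = poly.subalgebra hull ((\<lambda>A. Var T * (\<Prod>x\<in>A. Var (X x))) ` antichains P)"

definition toric_component ::
  "('a, 'm) gorder_scheme \<Rightarrow> nat \<Rightarrow> ('a, 'k::field) toric_poly set" where
  "toric_component P n =
    {f \<in> toric_ring P. \<forall>m\<in>Poly_Mapping.keys f. Poly_Mapping.lookup m T = n}"

end

theory Submission
  imports Defs
begin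

text \<open>
  The lattice consists of the down-sets \<open>I\<close> of \<open>P\<close>, and \<open>\<phi> I\<close> is the monomial \<open>t * x(max I)\<close>. A
  monomial \<open>t\<^sup>n * x\<^sup>a\<close> lies in the toric ring iff \<open>a\<close> has sum at most \<open>n\<close> along every chain, and then
  it is a standard monomial in exactly one way: the largest down-set \<open>I\<close> of the multichain must be
  the one generated by the support of \<open>a\<close>, and division by \<open>\<phi> I\<close> lowers all chain sums that were
  equal to \<open>n\<close>. Hence \<open>\<phi> I * \<phi> J\<close> is itself a standard monomial \<open>\<phi> H * \<phi> (I \<union> J)\<close>, and comparing
  exponents gives \<open>H \<subseteq> I \<inter> J\<close>.
\<close>

section \<open>Algebras spanned by monomials\<close>

lemma single_one_eq_iff [simp]:
  "Poly_Mapping.single m (1::'k::zero_neq_one) = Poly_Mapping.single n 1 \<longleftrightarrow> m = n"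
  by (metis keys_single singleton_inject zero_neq_one)

lemma lookup_poly_scale: "Poly_Mapping.lookup (poly_scale c f) m = c * Poly_Mapping.lookup f m"
  unfolding poly_scale_def mult_map_scale_conv_mult[symmetric]
  by (simp add: map.rep_eq when_def)

lemma poly_eq_sum_monomials:
  fixes f :: "('a, 'k::field) toric_poly"
  shows "f = (\<Sum>m\<in>Poly_Mapping.keys f.
    poly_scale (Poly_Mapping.lookup f m) (Poly_Mapping.single m 1))"
proof (rule poly_mapping_eqI)
  fix k
  have "(\<Sum>m\<in>Poly_Mapping.keys f.
        Poly_Mapping.lookup f m * Poly_Mapping.lookup (Poly_Mapping.single m (1::'k)) k) =
      (\<Sum>m\<in>Poly_Mapping.keys f. if m = k then Poly_Mapping.lookup f m else 0)"
    by (rule sum.cong) (auto simp: lookup_single when_def)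
  also have "\<dots> = Poly_Mapping.lookup f k"
    by (simp add: sum.delta' sum.delta in_keys_iff)
  finally show "Poly_Mapping.lookup f k =
      Poly_Mapping.lookup (\<Sum>m\<in>Poly_Mapping.keys f.
        poly_scale (Poly_Mapping.lookup f m) (Poly_Mapping.single m 1)) k"
    by (simp add: lookup_sum lookup_poly_scale)
qed

lemma keys_poly_scale: "Poly_Mapping.keys (poly_scale c f) \<subseteq> Poly_Mapping.keys f"
  by (auto simp: in_keys_iff lookup_poly_scale)

lemma subspace_keys_subset: "poly.subspace {f. Poly_Mapping.keys f \<subseteq> M}"
  by (auto simp: poly.subspace_def dest!: subsetD[OF keys_add] subsetD[OF keys_poly_scale])

lemma span_monomials:
  "poly.span ((\<lambda>m. Poly_Mapping.single m (1::'k::field)) ` M) =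
    {f :: ('a, 'k) toric_poly. Poly_Mapping.keys f \<subseteq> M}" (is "poly.span ?B = ?F")
proof
  show "poly.span ?B \<subseteq> ?F"
    by (rule poly.span_minimal) (auto simp: subspace_keys_subset)
  show "?F \<subseteq> poly.span ?B"
  proof
    fix f assume "f \<in> ?F"
    then have "(\<Sum>m\<in>Poly_Mapping.keys f.
        poly_scale (Poly_Mapping.lookup f m) (Poly_Mapping.single m 1)) \<in> poly.span ?B"
      by (intro poly.span_sum poly.span_scale poly.span_base) auto
    then show "f \<in> poly.span ?B"
      using poly_eq_sum_monomials[of f] by simp
  qed
qed

text \<open>Distinct monomials have disjoint keys, so the coefficient at \<open>m\<close> of a
  vanishing combination isolates the single scalar \<open>u v\<close>.\<close>

lemma independent_monomials:
  fixes M :: "('a toric_var \<Rightarrow>\<^sub>0 nat) set"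
  shows "poly.independent ((\<lambda>m. Poly_Mapping.single m (1::'k::field)) ` M)"
proof
  assume "poly.dependent ((\<lambda>m. Poly_Mapping.single m (1::'k)) ` M)"
  then obtain S and u :: "('a, 'k) toric_poly \<Rightarrow> 'k" and v
    where S: "finite S" "S \<subseteq> (\<lambda>m. Poly_Mapping.single m (1::'k)) ` M"
      and v: "v \<in> S" "u v \<noteq> 0" and zero: "(\<Sum>v\<in>S. poly_scale (u v) v) = 0"
    unfolding poly.dependent_explicit by blast
  obtain m where m: "v = Poly_Mapping.single m 1"
    using S(2) v(1) by blast
  have "u w * Poly_Mapping.lookup w m = (if w = v then u w else 0)" if w: "w \<in> S" for w
  proof -
    obtain n where "w = Poly_Mapping.single n 1"
      using S(2) w by blast
    then show ?thesis
      by (simp add: m lookup_single when_def)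
  qed
  then have "Poly_Mapping.lookup (\<Sum>v\<in>S. poly_scale (u v) v) m =
      (\<Sum>w\<in>S. if w = v then u w else 0)"
    unfolding lookup_sum lookup_poly_scale by (intro sum.cong) simp_all
  also have "\<dots> = u v"
    using S(1) v(1) by simp
  finally show False
    using zero v(2) by simp
qed

text \<open>The right-hand side has the nonzero coefficient \<open>r \<gamma>\<close> at
  \<open>e \<gamma>\<close>, whereas the left-hand side is nonzero only at \<open>m\<close>. This
  turns the straightening law into a statement about exponents.\<close>

lemma monomial_combination_eq_monomial:
  assumes "finite C" and "inj_on e C" and "\<forall>\<gamma>\<in>C. r \<gamma> \<noteq> 0" and "\<gamma> \<in> C"
    and eq: "Poly_Mapping.single m 1 =
      (\<Sum>\<gamma>\<in>C. poly_scale (r \<gamma>) (Poly_Mapping.single (e \<gamma>) (1::'k::field)))"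
  shows "e \<gamma> = m"
proof -
  have "Poly_Mapping.lookup (Poly_Mapping.single m (1::'k)) (e \<gamma>) =
      (\<Sum>\<delta>\<in>C. if \<delta> = \<gamma> then r \<delta> else 0)"
    unfolding eq lookup_sum lookup_poly_scale
    by (rule sum.cong) (use assms in \<open>auto simp: lookup_single when_def dest: inj_onD\<close>)
  also have "\<dots> = r \<gamma>"
    using assms by simp
  finally show ?thesis
    using assms(3,4) by (auto simp: lookup_single when_def split: if_splits)
qed

section \<open>Subalgebras and gradings given by sets of exponents\<close>

lemma subalgebra_keys_subset:
  assumes "0 \<in> M" and "\<And>m n. m \<in> M \<Longrightarrow> n \<in> M \<Longrightarrow> m + n \<in> M"
  shows "poly.subalgebra {f :: ('a, 'k::field) toric_poly. Poly_Mapping.keys f \<subseteq> M}"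
  unfolding poly.subalgebra_def
proof (intro conjI ballI)
  fix f g :: "('a, 'k) toric_poly"
  assume "f \<in> {f. Poly_Mapping.keys f \<subseteq> M}" "g \<in> {f. Poly_Mapping.keys f \<subseteq> M}"
  then show "f * g \<in> {f. Poly_Mapping.keys f \<subseteq> M}"
    using keys_mult[of f g] assms(2) by blast
qed (simp_all add: assms(1) subspace_keys_subset)

text \<open>\<open>M\<close> is a monoid of exponents with additive degree \<open>d\<close>, and a
  polynomial splits by sorting its terms by degree. Assumption \<open>d_0\<close> leaves only the
  constants in degree 0.\<close>

lemma graded_algebra_monomials:
  fixes M :: "('a toric_var \<Rightarrow>\<^sub>0 nat) set" and d :: "('a toric_var \<Rightarrow>\<^sub>0 nat) \<Rightarrow> nat"
  assumes M: "0 \<in> M" "\<And>m n. m \<in> M \<Longrightarrow> n \<in> M \<Longrightarrow> m + n \<in> M"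
    and d_add: "\<And>m n. d (m + n) = d m + d n"
    and d_0: "\<And>m. m \<in> M \<Longrightarrow> d m = 0 \<longleftrightarrow> m = 0"
  shows "graded_algebra poly_scale {f :: ('a, 'k::field) toric_poly. Poly_Mapping.keys f \<subseteq> M}
    (\<lambda>n. {f. Poly_Mapping.keys f \<subseteq> M \<and> (\<forall>m\<in>Poly_Mapping.keys f. d m = n)})"
proof (unfold_locales, goal_cases)
  case 1
  show ?case
    using M by (rule subalgebra_keys_subset)
next
  case (2 n)
  show ?case by blast
next
  case (3 n)
  have "{f. Poly_Mapping.keys f \<subseteq> M \<and> (\<forall>m\<in>Poly_Mapping.keys f. d m = n)} =
      {f :: ('a, 'k) toric_poly. Poly_Mapping.keys f \<subseteq> {m \<in> M. d m = n}}"
    by auto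
  then show ?case
    by (simp only: subspace_keys_subset)
next
  case (4 x m y n)
  have "k \<in> M \<and> d k = m + n" if k: "k \<in> Poly_Mapping.keys (x * y)" for k
  proof -
    obtain a b where "k = a + b" "a \<in> Poly_Mapping.keys x" "b \<in> Poly_Mapping.keys y"
      using k keys_mult[of x y] by blast
    then show ?thesis
      using 4 M(2)[of a b] d_add[of a b] by auto
  qed
  then show ?case
    by blast
next
  case 5
  show ?case
  proof (intro subset_antisym subsetI)
    fix f :: "('a, 'k) toric_poly"
    assume "f \<in> {f. Poly_Mapping.keys f \<subseteq> M \<and> (\<forall>m\<in>Poly_Mapping.keys f. d m = 0)}"
    then have "Poly_Mapping.keys f \<subseteq> {0}"
      using d_0 by auto
    then have "f = poly_scale (Poly_Mapping.lookup f 0) 1"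
      by (intro poly_mapping_eqI)
        (auto simp: lookup_poly_scale lookup_one when_def in_keys_iff subset_iff)
    then show "f \<in> (\<Union>c. {poly_scale c 1})"
      by blast
  next
    fix f :: "('a, 'k) toric_poly"
    assume "f \<in> (\<Union>c. {poly_scale c 1})"
    then have "Poly_Mapping.keys f \<subseteq> {0}"
      using keys_poly_scale[of _ 1] by auto
    then show "f \<in> {f. Poly_Mapping.keys f \<subseteq> M \<and> (\<forall>m\<in>Poly_Mapping.keys f. d m = 0)}"
      using M(1) d_0 by auto
  qed
next
  case (6 x)
  \<comment> \<open>Components of different degrees have disjoint keys, so only
    \<open>f (d m)\<close> contributes at \<open>m\<close>. Both existence and uniqueness of the
    decomposition rest on this.\<close>
  have lookup_component_sum: "Poly_Mapping.lookup (\<Sum>n | f n \<noteq> 0. f n) m =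
      Poly_Mapping.lookup (f (d m)) m"
    if f: "\<forall>n. f n \<in> {f. Poly_Mapping.keys f \<subseteq> M \<and> (\<forall>m\<in>Poly_Mapping.keys f. d m = n)}"
      "finite {n. f n \<noteq> 0}"
    for f :: "nat \<Rightarrow> ('a, 'k) toric_poly" and m
  proof -
    have "m \<notin> Poly_Mapping.keys (f n)" if "n \<noteq> d m" for n
      using spec[OF f(1), of n] that by auto
    then have "Poly_Mapping.lookup (\<Sum>n | f n \<noteq> 0. f n) m =
        (\<Sum>n | f n \<noteq> 0. if n = d m then Poly_Mapping.lookup (f n) m else 0)"
      unfolding lookup_sum by (intro sum.cong) (auto simp: in_keys_iff)
    also have "\<dots> = Poly_Mapping.lookup (f (d m)) m"
      using f by auto
    finally show ?thesis .
  qed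
  \<comment> \<open>The part of \<open>x\<close> of degree \<open>n\<close>; its support is finite
    because it lies in the keys of \<open>x\<close>.\<close>
  define h where
    "h n = Abs_poly_mapping (\<lambda>m. if d m = n then Poly_Mapping.lookup x m else 0)" for n
  have lookup_h: "Poly_Mapping.lookup (h n) m =
      (if d m = n then Poly_Mapping.lookup x m else 0)" for n m
  proof -
    have "finite {m. (if d m = n then Poly_Mapping.lookup x m else 0) \<noteq> 0}"
      by (rule finite_subset[OF _ finite_keys[of x]]) (auto simp: in_keys_iff)
    then show ?thesis
      by (simp add: h_def)
  qed
  have h_component: "\<forall>n. h n \<in> {f. Poly_Mapping.keys f \<subseteq> M \<and> (\<forall>m\<in>Poly_Mapping.keys f. d m = n)}"
    using 6 by (auto simp: in_keys_iff lookup_h subset_iff split: if_splits)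
  have "{n. h n \<noteq> 0} \<subseteq> d ` Poly_Mapping.keys x"
    by (auto simp: poly_mapping_eq_iff fun_eq_iff lookup_h in_keys_iff split: if_splits)
  then have h_finite: "finite {n. h n \<noteq> 0}"
    by (rule finite_subset) simp
  show ?case
  proof (rule ex1I[of _ h])
    have "x = (\<Sum>n | h n \<noteq> 0. h n)"
      by (rule poly_mapping_eqI) (simp add: lookup_component_sum[OF h_component h_finite] lookup_h)
    with h_component h_finite
    show "(\<forall>n. h n \<in> {f. Poly_Mapping.keys f \<subseteq> M \<and> (\<forall>m\<in>Poly_Mapping.keys f. d m = n)}) \<and>
        finite {n. h n \<noteq> 0} \<and> x = (\<Sum>n | h n \<noteq> 0. h n)"
      by blast
  next
    fix f
    assume f: "(\<forall>n. f n \<in> {f. Poly_Mapping.keys f \<subseteq> M \<and> (\<forall>m\<in>Poly_Mapping.keys f. d m = n)}) \<and>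
        finite {n. f n \<noteq> 0} \<and> x = (\<Sum>n | f n \<noteq> 0. f n)"
    have "Poly_Mapping.lookup (f n) m = Poly_Mapping.lookup (h n) m" for n m
    proof (cases "d m = n")
      case True
      then show ?thesis
        using lookup_component_sum[of f m] f by (simp add: lookup_h)
    next
      case False
      then have "m \<notin> Poly_Mapping.keys (f n)"
        using spec[OF conjunct1[OF f], of n] by auto
      then show ?thesis
        using False by (simp add: lookup_h in_keys_iff)
    qed
    then show "f = h"
      by (intro ext poly_mapping_eqI)
  qed
qed

lemma prod_single:
  "(\<Prod>x\<in>A. Poly_Mapping.single (f x) (1::'k::comm_semiring_1)) =
    Poly_Mapping.single (\<Sum>x\<in>A. f x) 1"
  by (induction A rule: infinite_finite_induct) (simp_all add: mult_single)

lemma prod_list_single: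
  "(\<Prod>x\<leftarrow>xs. Poly_Mapping.single (f x) (1::'k::comm_semiring_1)) =
    Poly_Mapping.single (\<Sum>x\<leftarrow>xs. f x) 1"
  by (induction xs) (simp_all add: mult_single)

section \<open>Lattices of sets\<close>

text \<open>\<open>g\<close> turns joins into unions and meets into intersections, so distributivity
  of sets pulls back along the injective \<open>g\<close>. The carrier is an arbitrary index set for
  \<open>F\<close>, so that the down-sets can later be numbered.\<close>

lemma distributive_lattice_of_sets:
  fixes L :: "'b gorder"
  assumes bij: "bij_betw g (carrier L) F"
    and closed: "\<And>I J. I \<in> F \<Longrightarrow> J \<in> F \<Longrightarrow> I \<union> J \<in> F \<and> I \<inter> J \<in> F"
    and eq: "eq L = (=)" and le: "\<And>i j. le L i j \<longleftrightarrow> g i \<subseteq> g j"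
  shows "distributive_lattice L"
proof -
  have inj: "i = j" if "g i = g j" "i \<in> carrier L" "j \<in> carrier L" for i j
    using bij that by (auto simp: bij_betw_def dest: inj_onD)
  have in_F: "g i \<in> F" if "i \<in> carrier L" for i
    using bij that by (auto simp: bij_betw_def)
  have ex: "\<exists>i\<in>carrier L. g i = I" if "I \<in> F" for I
    using bij that by (auto simp: bij_betw_def)
  interpret partial_order L
    by unfold_locales (auto simp: eq le intro: inj)
  have least: "\<exists>s. least L s (Upper L {i, j}) \<and> g s = g i \<union> g j"
    if ij: "i \<in> carrier L" "j \<in> carrier L" for i j
  proof -
    obtain s where "s \<in> carrier L" "g s = g i \<union> g j"
      using ex[of "g i \<union> g j"] closed in_F ij by blast
    then show ?thesis
      using ij by (intro exI[of _ s]) (auto simp: least_def Upper_def le)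
  qed
  have greatest: "\<exists>s. greatest L s (Lower L {i, j}) \<and> g s = g i \<inter> g j"
    if ij: "i \<in> carrier L" "j \<in> carrier L" for i j
  proof -
    obtain s where "s \<in> carrier L" "g s = g i \<inter> g j"
      using ex[of "g i \<inter> g j"] closed in_F ij by blast
    then show ?thesis
      using ij by (intro exI[of _ s]) (auto simp: greatest_def Lower_def le)
  qed
  interpret lattice L
    by unfold_locales (use least greatest in blast)+
  \<comment> \<open>The join is a chosen least upper bound, so \<open>joinI\<close> asks for the
    property of an arbitrary one; uniqueness identifies it with the one named by the union.\<close>
  have join: "g (i \<squnion>\<^bsub>L\<^esub> j) = g i \<union> g j" if ij: "i \<in> carrier L" "j \<in> carrier L" for i j
  proof (rule joinI[OF _ ij])
    fix l
    assume l: "least L l (Upper L {i, j})"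
    obtain s where s: "least L s (Upper L {i, j})" "g s = g i \<union> g j"
      using least[OF ij] by auto
    have "l = s"
      using l s(1) by (rule least_unique)
    then show "g l = g i \<union> g j"
      using s(2) by simp
  qed
  have meet: "g (i \<sqinter>\<^bsub>L\<^esub> j) = g i \<inter> g j" if ij: "i \<in> carrier L" "j \<in> carrier L" for i j
  proof (rule meetI[OF _ ij])
    fix l
    assume l: "greatest L l (Lower L {i, j})"
    obtain s where s: "greatest L s (Lower L {i, j})" "g s = g i \<inter> g j"
      using greatest[OF ij] by auto
    have "l = s"
      using l s(1) by (rule greatest_unique)
    then show "g l = g i \<inter> g j"
      using s(2) by simp
  qed
  show ?thesis
    by unfold_locales (auto intro!: inj simp: join meet)
qed

section \<open>Down-sets and exponent vectors\<close>

definition antichain_exponent :: "'a set \<Rightarrow> 'a toric_var \<Rightarrow>\<^sub>0 nat" where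
  "antichain_exponent A = Poly_Mapping.single T 1 + (\<Sum>x\<in>A. Poly_Mapping.single (X x) 1)"

lemma antichain_monomial:
  "Var T * (\<Prod>x\<in>A. Var (X x)) = Poly_Mapping.single (antichain_exponent A) 1"
  by (simp add: Var_def antichain_exponent_def prod_single mult_single)

lemma lookup_antichain_exponent_T [simp]: "Poly_Mapping.lookup (antichain_exponent A) T = 1"
  by (simp add: antichain_exponent_def lookup_add lookup_sum lookup_single)

lemma lookup_antichain_exponent_X [simp]:
  assumes "finite A"
  shows "Poly_Mapping.lookup (antichain_exponent A) (X x) = (if x \<in> A then 1 else 0)"
  using assms by (simp add: antichain_exponent_def lookup_add lookup_sum lookup_single when_def)

locale finite_poset = partial_order P for P :: "'a gorder" (structure) +
  assumes finite_carrier: "finite (carrier P)"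
begin

definition maximals :: "'a set \<Rightarrow> 'a set" where
  "maximals S = {x \<in> S. \<forall>y\<in>S. x \<sqsubseteq> y \<longrightarrow> x = y}"

definition down :: "'a set \<Rightarrow> 'a set" where
  "down S = {y \<in> carrier P. \<exists>x\<in>S. y \<sqsubseteq> x}"

definition down_sets :: "'a set set" where
  "down_sets = {I. I \<subseteq> carrier P \<and> (\<forall>x\<in>I. \<forall>y\<in>carrier P. y \<sqsubseteq> x \<longrightarrow> y \<in> I)}"

definition chains :: "'a set set" where
  "chains = {C. C \<subseteq> carrier P \<and> (\<forall>x\<in>C. \<forall>y\<in>C. x \<sqsubseteq> y \<or> y \<sqsubseteq> x)}"

definition support :: "('a toric_var \<Rightarrow>\<^sub>0 nat) \<Rightarrow> 'a set" where
  "support m = {x. Poly_Mapping.lookup m (X x) \<noteq> 0}"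

text \<open>The lattice points of the cone over the chain polytope, with the exponent of
  \<open>T\<close> as height. Since exponents are nonnegative, bounding all chains agrees with
  bounding the maximal ones, and the bound then applies directly to singletons and to parts of
  chains.\<close>

definition cone :: "('a toric_var \<Rightarrow>\<^sub>0 nat) set" where
  "cone = {m. support m \<subseteq> carrier P \<and>
    (\<forall>C\<in>chains. (\<Sum>x\<in>C. Poly_Mapping.lookup m (X x)) \<le> Poly_Mapping.lookup m T)}"

definition exponent :: "'a set list \<Rightarrow> 'a toric_var \<Rightarrow>\<^sub>0 nat" where
  "exponent Is = (\<Sum>I\<leftarrow>Is. antichain_exponent (maximals I))"

section \<open>Finiteness, maximal elements and generated down-sets\<close>

lemma finite_down_set: "I \<in> down_sets \<Longrightarrow> finite I"
  using finite_carrier finite_subset by (auto simp: down_sets_def)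

lemma finite_chain: "C \<in> chains \<Longrightarrow> finite C"
  using finite_carrier finite_subset by (auto simp: chains_def)

lemma finite_down_sets: "finite down_sets"
  by (rule finite_subset[of _ "Pow (carrier P)"]) (auto simp: down_sets_def finite_carrier)

lemma finite_maximals: "I \<in> down_sets \<Longrightarrow> finite (maximals I)"
  using finite_down_set by (auto simp: maximals_def)

text \<open>Moving from a nonmaximal \<open>x\<close> to a strictly larger element of
  \<open>S\<close> shrinks the finite set of elements of \<open>S\<close> above it, so the climb
  ends.\<close>

lemma maximals_above:
  assumes "S \<subseteq> carrier P" and "x \<in> S"
  shows "\<exists>a\<in>maximals S. x \<sqsubseteq> a"
  using assms(2)
proof (induction "card {y \<in> S. x \<sqsubseteq> y}" arbitrary: x rule: less_induct)
  case less
  show ?case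
  proof (cases "x \<in> maximals S")
    case True
    then show ?thesis
      using less.prems assms(1) by (intro bexI[of _ x]) auto
  next
    case False
    then obtain y where y: "y \<in> S" "x \<sqsubseteq> y" "x \<noteq> y"
      using less.prems by (auto simp: maximals_def)
    have fin: "finite {y \<in> S. x \<sqsubseteq> y}"
      using assms(1) finite_carrier finite_subset by fastforce
    have "{z \<in> S. y \<sqsubseteq> z} \<subset> {z \<in> S. x \<sqsubseteq> z}"
    proof
      show "{z \<in> S. y \<sqsubseteq> z} \<subseteq> {z \<in> S. x \<sqsubseteq> z}"
        using y less.prems assms(1) by (auto intro: le_trans)
      have "x \<in> {z \<in> S. x \<sqsubseteq> z}" "x \<notin> {z \<in> S. y \<sqsubseteq> z}"
        using y less.prems assms(1) le_antisym by auto
      then show "{z \<in> S. y \<sqsubseteq> z} \<noteq> {z \<in> S. x \<sqsubseteq> z}"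
        by blast
    qed
    then obtain a where "a \<in> maximals S" "y \<sqsubseteq> a"
      using less.hyps[of y] y(1) psubset_card_mono[OF fin] by blast
    then show ?thesis
      using y less.prems assms(1) le_trans[of x y a] by (auto simp: maximals_def)
  qed
qed

lemma down_in_down_sets:
  assumes "S \<subseteq> carrier P"
  shows "down S \<in> down_sets"
proof -
  have "y \<in> down S" if x: "x \<in> down S" and y: "y \<in> carrier P" "y \<sqsubseteq> x" for x y
  proof -
    obtain s where s: "s \<in> S" "x \<sqsubseteq> s"
      using x by (auto simp: down_def)
    then have "y \<sqsubseteq> s"
      using x y assms by (intro le_trans[of y x s]) (auto simp: down_def)
    then show ?thesis
      using s y by (auto simp: down_def)
  qed
  then show ?thesis
    by (auto simp: down_sets_def down_def)
qed

lemma subset_down: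
  assumes "S \<subseteq> carrier P"
  shows "S \<subseteq> down S"
proof
  fix x
  assume "x \<in> S"
  moreover from this have "x \<in> carrier P" "x \<sqsubseteq> x"
    using assms by auto
  ultimately show "x \<in> down S"
    by (auto simp: down_def)
qed

lemma down_subset: "I \<in> down_sets \<Longrightarrow> S \<subseteq> I \<Longrightarrow> down S \<subseteq> I"
  by (auto simp: down_def down_sets_def)

lemma down_set_subset_down_maximals:
  assumes "I \<in> down_sets"
  shows "I \<subseteq> down (maximals I)"
proof
  fix x
  assume "x \<in> I"
  moreover have "I \<subseteq> carrier P"
    using assms by (simp add: down_sets_def)
  ultimately show "x \<in> down (maximals I)"
    using maximals_above[of I x] by (auto simp: down_def)
qed

text \<open>Each element of \<open>down S\<close> lies below one of \<open>S\<close>, so passing to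
  \<open>down S\<close> neither creates nor destroys maximal elements.\<close>

lemma maximals_down:
  assumes "S \<subseteq> carrier P"
  shows "maximals (down S) = maximals S"
proof (intro subset_antisym subsetI)
  have S: "S \<subseteq> down S"
    using assms by (rule subset_down)
  fix x
  assume x: "x \<in> maximals (down S)"
  then obtain s where s: "s \<in> S" "x \<sqsubseteq> s"
    by (auto simp: maximals_def down_def)
  then have "x = s"
    using x S by (auto simp: maximals_def)
  then show "x \<in> maximals S"
    using x s S by (auto simp: maximals_def)
next
  fix x
  assume x: "x \<in> maximals S"
  have "x = y" if y: "y \<in> down S" "x \<sqsubseteq> y" for y
  proof -
    obtain s where s: "s \<in> S" "y \<sqsubseteq> s" "y \<in> carrier P"
      using y by (auto simp: down_def)
    have "x \<in> carrier P" "s \<in> carrier P"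
      using x s assms by (auto simp: maximals_def)
    moreover from this have "x = s"
      using x s y le_trans[of x y s] by (auto simp: maximals_def)
    ultimately show ?thesis
      using s y le_antisym by auto
  qed
  then show "x \<in> maximals (down S)"
    using x subset_down[OF assms] by (auto simp: maximals_def)
qed

lemma maximals_antichain: "I \<in> down_sets \<Longrightarrow> maximals I \<in> antichains P"
  by (auto simp: maximals_def antichains_def down_sets_def)

section \<open>The cone of exponents and the decomposition of its elements\<close>

lemma zero_in_cone: "0 \<in> cone"
  by (simp add: cone_def support_def)

lemma add_in_cone:
  assumes "m \<in> cone" and "n \<in> cone"
  shows "m + n \<in> cone"
  using assms by (fastforce simp: cone_def support_def lookup_add sum.distrib add_mono)

text \<open>Singletons are chains, so the exponent of \<open>T\<close> bounds that of each
  \<open>X x\<close> with \<open>x\<close> in the carrier; the others vanish.\<close>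

lemma cone_T_eq_0_iff:
  assumes "m \<in> cone"
  shows "Poly_Mapping.lookup m T = 0 \<longleftrightarrow> m = 0"
proof
  assume T: "Poly_Mapping.lookup m T = 0"
  have "Poly_Mapping.lookup m (X x) = 0" for x
  proof (cases "x \<in> carrier P")
    case True
    then have "{x} \<in> chains"
      by (simp add: chains_def)
    then have "(\<Sum>y\<in>{x}. Poly_Mapping.lookup m (X y)) \<le> Poly_Mapping.lookup m T"
      using assms by (auto simp only: cone_def)
    then show ?thesis
      using T by simp
  next
    case False
    then show ?thesis
      using assms by (auto simp: cone_def support_def)
  qed
  then show "m = 0"
    using T by (intro poly_mapping_eqI) (metis lookup_zero toric_var.exhaust)
qed simp

text \<open>A chain meets an antichain in at most one element.\<close>

lemma antichain_exponent_in_cone: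
  assumes "A \<in> antichains P"
  shows "antichain_exponent A \<in> cone"
proof -
  have A: "A \<subseteq> carrier P"
    using assms by (simp add: antichains_def)
  then have fin: "finite A"
    using finite_carrier by (rule finite_subset)
  have "(\<Sum>x\<in>C. Poly_Mapping.lookup (antichain_exponent A) (X x)) \<le> 1" if C: "C \<in> chains" for C
  proof -
    have "card (C \<inter> A) \<le> 1"
      unfolding One_nat_def
    proof (subst card_le_Suc0_iff_eq)
      show "finite (C \<inter> A)"
        using fin by simp
      have "x \<sqsubseteq> y \<or> y \<sqsubseteq> x" if "x \<in> C" "y \<in> C" for x y
        using C that by (simp add: chains_def)
      moreover have "x = y" if "x \<in> A" "y \<in> A" "x \<sqsubseteq> y \<or> y \<sqsubseteq> x" for x y
        using assms that unfolding antichains_def by auto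
      ultimately show "\<forall>x\<in>C \<inter> A. \<forall>y\<in>C \<inter> A. x = y"
        by simp
    qed
    then show ?thesis
      using fin finite_chain[OF C] by (simp add: sum.If_cases Int_def)
  qed
  then show ?thesis
    using A fin by (auto simp: cone_def support_def split: if_splits)
qed

text \<open>Induction on the exponent of \<open>T\<close>: removing one \<open>T\<close> and the
  maximal elements \<open>A\<close> of the support stays in the cone, and
  \<open>down (support m)\<close> is appended to the list found for the rest. The last clause
  strengthens the induction: supports only shrink, so the extended list is still increasing.\<close>

lemma cone_decomposition:
  assumes "m \<in> cone"
  shows "\<exists>Is. set Is \<subseteq> down_sets \<and> sorted_wrt (\<subseteq>) Is \<and> exponent Is = m \<and>
    (\<forall>I\<in>set Is. I \<subseteq> down (support m))"
  using assms
proof (induction "Poly_Mapping.lookup m T" arbitrary: m)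
  case 0
  then have "m = 0"
    using cone_T_eq_0_iff by simp
  then show ?case
    by (intro exI[of _ "[]"]) (simp add: exponent_def)
next
  case (Suc n)
  define A where "A = maximals (support m)"
  have S: "support m \<subseteq> carrier P"
    using Suc.prems by (simp add: cone_def)
  have A: "A \<subseteq> support m" "finite A"
    using finite_subset[OF S finite_carrier] by (auto simp: A_def maximals_def)
  \<comment> \<open>Subtraction is truncated, but nothing is lost: exponents on \<open>A\<close> are
    positive and that of \<open>T\<close> is \<open>Suc n\<close>.\<close>
  define m' where "m' = m - antichain_exponent A"
  have m'_T: "Poly_Mapping.lookup m' T = n"
    using Suc.hyps(2) by (simp add: m'_def lookup_minus)
  have m_X: "Poly_Mapping.lookup m (X x) =
      Poly_Mapping.lookup m' (X x) + (if x \<in> A then 1 else 0)" for x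
    using A by (auto simp: m'_def lookup_minus support_def)
  have m: "m = m' + antichain_exponent A"
  proof (rule poly_mapping_eqI)
    show "Poly_Mapping.lookup m v = Poly_Mapping.lookup (m' + antichain_exponent A) v" for v
      using A Suc.hyps(2) m'_T m_X by (cases v) (simp_all add: lookup_add)
  qed
  have support_m': "support m' \<subseteq> support m"
    by (auto simp: support_def m_X)
  have "(\<Sum>x\<in>C. Poly_Mapping.lookup m' (X x)) \<le> n" if C: "C \<in> chains" for C
  proof (cases "C \<inter> A = {}")
    \<comment> \<open>A chain meeting \<open>A\<close> loses at least 1, so its sum drops from at
      most \<open>Suc n\<close> to at most \<open>n\<close>.\<close>
    case False
    have "(\<Sum>x\<in>C. Poly_Mapping.lookup m (X x)) =
        (\<Sum>x\<in>C. Poly_Mapping.lookup m' (X x)) + card (C \<inter> A)"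
      using finite_chain[OF C] by (simp add: m_X sum.distrib sum.If_cases Int_def)
    moreover have "card (C \<inter> A) \<noteq> 0"
      using False A by simp
    moreover have "(\<Sum>x\<in>C. Poly_Mapping.lookup m (X x)) \<le> Suc n"
      using C Suc.prems Suc.hyps(2) by (simp add: cone_def)
    ultimately show ?thesis
      by linarith
  next
    case disjoint: True
    show ?thesis
    proof (cases "C \<inter> support m = {}")
      case True
      then have "Poly_Mapping.lookup m' (X x) = 0" if "x \<in> C" for x
        using that support_m' by (auto simp: support_def)
      then show ?thesis
        by simp
    next
      case False
      have CS: "C \<inter> support m \<subseteq> carrier P"
        using S by blast
      \<comment> \<open>\<open>c\<close> is the top of the part of \<open>C\<close> in the support.
        Some \<open>a\<close> in \<open>A\<close> lies above it, and \<open>a\<close> is not in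
        \<open>C\<close>, which avoids \<open>A\<close>.\<close>
      obtain c where c: "c \<in> maximals (C \<inter> support m)"
        using False maximals_above[OF CS] by blast
      obtain a where a: "a \<in> A" "c \<sqsubseteq> a"
        using c maximals_above[OF S, of c] by (auto simp: A_def maximals_def)
      have a_carrier: "a \<in> carrier P"
        using a(1) A(1) S by blast
      \<comment> \<open>The part of \<open>C\<close> in the support lies strictly below \<open>a\<close>, so \<open>a\<close> can be added to it.\<close>
      have "x \<sqsubseteq> a" if x: "x \<in> C \<inter> support m" for x
      proof -
        have "x \<sqsubseteq> c \<or> c \<sqsubseteq> x"
          using x c C by (simp add: maximals_def chains_def)
        moreover have "c \<sqsubseteq> x \<Longrightarrow> c = x"
          using x c by (simp add: maximals_def)
        ultimately have "x \<sqsubseteq> c"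
          by auto
        moreover have "c \<in> carrier P" "x \<in> carrier P"
          using c x CS by (auto simp: maximals_def)
        ultimately show ?thesis
          using a(2) a_carrier le_trans by blast
      qed
      then have "insert a (C \<inter> support m) \<in> chains"
        using C a_carrier by (simp add: chains_def subset_iff)
      \<comment> \<open>The enlarged chain has sum at most \<open>Suc n\<close>, of which
        \<open>a\<close> takes at least 1; at most \<open>n\<close> remains for
        \<open>C\<close>.\<close>
      then have "(\<Sum>x\<in>insert a (C \<inter> support m). Poly_Mapping.lookup m (X x)) \<le> Suc n"
        using Suc.prems Suc.hyps(2) by (auto simp only: cone_def)
      moreover have "a \<notin> C \<inter> support m"
        using a disjoint by blast
      moreover have "Poly_Mapping.lookup m (X a) \<noteq> 0"
        using a A by (auto simp: support_def)
      ultimately have "(\<Sum>x\<in>C \<inter> support m. Poly_Mapping.lookup m (X x)) \<le> n"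
        using finite_chain[OF C] by simp
      moreover have "(\<Sum>x\<in>C. Poly_Mapping.lookup m' (X x)) =
          (\<Sum>x\<in>C \<inter> support m. Poly_Mapping.lookup m' (X x))"
        using finite_chain[OF C] support_m'
        by (intro sum.mono_neutral_right) (auto simp: support_def)
      moreover have "\<dots> \<le> (\<Sum>x\<in>C \<inter> support m. Poly_Mapping.lookup m (X x))"
        by (intro sum_mono) (simp add: m_X)
      ultimately show ?thesis
        by linarith
    qed
  qed
  then have "m' \<in> cone"
    using S support_m' m'_T by (auto simp: cone_def)
  then obtain Is where Is: "set Is \<subseteq> down_sets" "sorted_wrt (\<subseteq>) Is" "exponent Is = m'"
      "\<forall>I\<in>set Is. I \<subseteq> down (support m')"
    using Suc.hyps(1)[of m'] m'_T by blast
  have "down (support m') \<subseteq> down (support m)"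
    using support_m' by (auto simp: down_def)
  then have "\<forall>I\<in>set Is. I \<subseteq> down (support m)"
    using Is(4) by blast
  moreover have "exponent (Is @ [down (support m)]) = m"
    using Is(3) m maximals_down[OF S] by (simp add: exponent_def A_def)
  ultimately show ?case
    using Is(1,2) down_in_down_sets[OF S]
    by (intro exI[of _ "Is @ [down (support m)]"]) (simp add: sorted_wrt_append)
qed

section \<open>Uniqueness of decompositions and comparison of pairs\<close>

lemma exponent_T: "Poly_Mapping.lookup (exponent Is) T = length Is"
  by (induction Is) (simp_all add: exponent_def lookup_add)

lemma support_exponent:
  assumes "set Is \<subseteq> down_sets"
  shows "support (exponent Is) = (\<Union>I\<in>set Is. maximals I)"
  using assms
  by (induction Is) (auto simp: support_def exponent_def lookup_add finite_maximals split: if_splits)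

lemma exponent_in_cone: "set Is \<subseteq> down_sets \<Longrightarrow> exponent Is \<in> cone"
  by (induction Is)
    (simp_all add: exponent_def zero_in_cone add_in_cone antichain_exponent_in_cone maximals_antichain)

text \<open>The maximal elements of all entries lie in the largest entry \<open>I\<close>, and those
  of \<open>I\<close> alone generate it. Hence the last entry can be read off from the
  exponent.\<close>

lemma down_support_exponent:
  assumes "set (Is @ [I]) \<subseteq> down_sets" and "sorted_wrt (\<subseteq>) (Is @ [I])"
  shows "down (support (exponent (Is @ [I]))) = I"
proof
  have "support (exponent (Is @ [I])) \<subseteq> I"
    unfolding support_exponent[OF assms(1)] using assms(2)
    by (auto simp: sorted_wrt_append maximals_def)
  then show "down (support (exponent (Is @ [I]))) \<subseteq> I"
    using assms(1) by (intro down_subset) auto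
  have "down (maximals I) \<subseteq> down (support (exponent (Is @ [I])))"
    unfolding support_exponent[OF assms(1)] by (auto simp: down_def)
  with down_set_subset_down_maximals[of I] assms(1)
  show "I \<subseteq> down (support (exponent (Is @ [I])))"
    by (meson in_set_conv_decomp subset_trans subsetD)
qed

text \<open>The exponent of \<open>T\<close> gives the length and
  \<open>down_support_exponent\<close> the last entry, whose contribution is then cancelled.\<close>

lemma exponent_inject:
  assumes "set Is \<subseteq> down_sets" "sorted_wrt (\<subseteq>) Is" "set Js \<subseteq> down_sets" "sorted_wrt (\<subseteq>) Js"
    and "exponent Is = exponent Js"
  shows "Is = Js"
  using assms
proof (induction Is arbitrary: Js rule: rev_induct)
  case Nil
  then show ?case
    using exponent_T[of Js] exponent_T[of "[]"] by simp
next
  case (snoc I Is)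
  then have "length Js = length (Is @ [I])"
    by (metis exponent_T)
  then obtain Js' J where Js: "Js = Js' @ [J]"
    by (metis length_greater_0_conv rev_exhaust snoc_eq_iff_butlast)
  then have "I = J"
    using snoc.prems down_support_exponent by metis
  then have "exponent Is = exponent Js'"
    using snoc.prems Js by (simp add: exponent_def)
  then have "Is = Js'"
    using snoc.IH[of Js'] snoc.prems Js by (simp add: sorted_wrt_append)
  then show ?case
    using Js \<open>I = J\<close> by simp
qed

text \<open>\<open>J\<close> is generated by the maximal elements of \<open>A\<close> and
  \<open>B\<close>. If \<open>x\<close> is maximal in \<open>H\<close> but not in \<open>A\<close>,
  comparing exponents makes \<open>x\<close> maximal in \<open>B\<close> and not in
  \<open>J\<close>, so \<open>x\<close> lies strictly below some \<open>z\<close> maximal in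
  \<open>A\<close> or \<open>B\<close>. Then either \<open>z\<close> is in \<open>A\<close>, which
  forces \<open>x\<close> into \<open>A\<close>, or \<open>x\<close> is not maximal in
  \<open>B\<close>.\<close>

lemma exponent_pair_subset:
  assumes D: "{H, J, A, B} \<subseteq> down_sets" and "H \<subseteq> J" and eq: "exponent [H, J] = exponent [A, B]"
  shows "H \<subseteq> A"
proof -
  have J: "J = down (maximals A \<union> maximals B)"
    using down_support_exponent[of "[H]" J] support_exponent[of "[A, B]"] D \<open>H \<subseteq> J\<close> eq by simp
  have count: "(if x \<in> maximals H then 1 else 0) + (if x \<in> maximals J then 1 else 0) =
      (if x \<in> maximals A then 1 else 0) + (if x \<in> maximals B then 1 else (0::nat))" for x
    using arg_cong[OF eq, of "\<lambda>m. Poly_Mapping.lookup m (X x)"] D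
    by (simp add: exponent_def lookup_add finite_maximals)
  have "maximals H \<subseteq> A"
  proof
    fix x
    assume x: "x \<in> maximals H"
    show "x \<in> A"
    proof (rule ccontr)
      assume "x \<notin> A"
      then have "x \<notin> maximals A"
        by (simp add: maximals_def)
      then have xB: "x \<in> maximals B" and xJ: "x \<notin> maximals J"
        using count[of x] x by (auto split: if_splits)
      have "x \<in> J"
        using x \<open>H \<subseteq> J\<close> by (auto simp: maximals_def)
      then obtain y where y: "y \<in> J" "x \<sqsubseteq> y" "x \<noteq> y"
        using xJ by (auto simp: maximals_def)
      then obtain z where z: "z \<in> maximals A \<union> maximals B" "y \<sqsubseteq> z"
        by (auto simp: J down_def)
      have carr: "x \<in> carrier P" "y \<in> carrier P" "z \<in> carrier P"
        using xB y z D by (auto simp: maximals_def down_sets_def)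
      then have xz: "x \<sqsubseteq> z"
        using y z le_trans by blast
      show False
      proof (cases "z \<in> A")
        case True
        then show False
          using xz carr \<open>x \<notin> A\<close> D by (auto simp: down_sets_def)
      next
        case False
        then have "z = x"
          using z xz xB by (auto simp: maximals_def)
        then show False
          using y z carr le_antisym by blast
      qed
    qed
  qed
  then have "down (maximals H) \<subseteq> A"
    using D by (intro down_subset) auto
  then show ?thesis
    using down_set_subset_down_maximals[of H] D by blast
qed

section \<open>The toric ring as the span of the cone monomials\<close>

lemma exponent_image:
  "exponent ` {Is. set Is \<subseteq> down_sets \<and> sorted_wrt (\<subseteq>) Is} = cone"
  using cone_decomposition exponent_in_cone by fastforce

text \<open>Polynomials with exponents in the cone form a subalgebra containing the generators.
  Conversely, by \<open>exponent_image\<close>, each monomial of the cone is a product of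
  generators.\<close>

lemma toric_ring_eq: "toric_ring P = {f :: ('a, 'k::field) toric_poly. Poly_Mapping.keys f \<subseteq> cone}"
proof
  let ?G = "(\<lambda>A. Var T * (\<Prod>x\<in>A. Var (X x)) :: ('a, 'k) toric_poly) ` antichains P"
  show "toric_ring P \<subseteq> {f :: ('a, 'k) toric_poly. Poly_Mapping.keys f \<subseteq> cone}"
    unfolding toric_ring_def
  proof (rule hull_minimal)
    show "?G \<subseteq> {f. Poly_Mapping.keys f \<subseteq> cone}"
      by (auto simp: antichain_monomial antichain_exponent_in_cone)
    show "poly.subalgebra {f :: ('a, 'k) toric_poly. Poly_Mapping.keys f \<subseteq> cone}"
      using zero_in_cone add_in_cone by (rule subalgebra_keys_subset)
  qed
  have alg: "poly.subalgebra (toric_ring P :: ('a, 'k) toric_poly set)"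
    unfolding toric_ring_def
    by (rule hull_in) (auto simp: poly.subalgebra_def poly.subspace_def)
  have "Poly_Mapping.single (exponent Is) 1 \<in> (toric_ring P :: ('a, 'k) toric_poly set)"
    if "set Is \<subseteq> down_sets" for Is
    using that
  proof (induction Is)
    case Nil
    then show ?case
      using alg by (simp add: exponent_def poly.subalgebra_def)
  next
    case (Cons I Is)
    have "Poly_Mapping.single (antichain_exponent (maximals I)) 1 \<in>
        (toric_ring P :: ('a, 'k) toric_poly set)"
      unfolding toric_ring_def antichain_monomial[symmetric]
      using Cons.prems by (intro hull_inc imageI maximals_antichain) simp
    then have "Poly_Mapping.single (antichain_exponent (maximals I)) 1 *
        Poly_Mapping.single (exponent Is) 1 \<in> (toric_ring P :: ('a, 'k) toric_poly set)"
      using alg Cons by (simp add: poly.subalgebra_def)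
    then show ?case
      by (simp add: mult_single exponent_def)
  qed
  then have "(\<lambda>m. Poly_Mapping.single m 1) ` cone \<subseteq> (toric_ring P :: ('a, 'k) toric_poly set)"
    unfolding exponent_image[symmetric] by auto
  then have "poly.span ((\<lambda>m. Poly_Mapping.single m 1) ` cone) \<subseteq>
      (toric_ring P :: ('a, 'k) toric_poly set)"
    using alg by (intro poly.span_minimal) (auto simp: poly.subalgebra_def)
  then show "{f :: ('a, 'k) toric_poly. Poly_Mapping.keys f \<subseteq> cone} \<subseteq> toric_ring P"
    unfolding span_monomials .
qed

lemma graded_algebra_toric_ring:
  "graded_algebra poly_scale (toric_ring P :: ('a, 'k::field) toric_poly set) (toric_component P)"
proof -
  have "toric_component P = (\<lambda>n. {f :: ('a, 'k) toric_poly. Poly_Mapping.keys f \<subseteq> cone \<and>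
      (\<forall>m\<in>Poly_Mapping.keys f. Poly_Mapping.lookup m T = n)})"
    by (rule ext) (simp add: toric_component_def toric_ring_eq)
  then show ?thesis
    unfolding toric_ring_eq using zero_in_cone add_in_cone cone_T_eq_0_iff
    by (simp add: graded_algebra_monomials lookup_add)
qed

end

section \<open>Straightening\<close>

theorem theorem2p1:
  fixes P :: "'a gorder"
  assumes "partial_order P" and "finite (carrier P)"
  shows "\<exists>(L :: nat gorder) (\<phi> :: nat \<Rightarrow> ('a, 'k::field) toric_poly).
    distributive_lattice L \<and> finite (carrier L) \<and>
    algebra_with_straightening_laws poly_scale (toric_ring P) (toric_component P) L \<phi>"
proof -
  interpret finite_poset P
    using assms by (simp add: finite_poset_def finite_poset_axioms_def)
  \<comment> \<open>The down-sets are numbered because the lattice to be found has elements of type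
    \<open>nat\<close>.\<close>
  obtain g where g: "bij_betw g {0..<card down_sets} down_sets"
    using ex_bij_betw_nat_finite[OF finite_down_sets] by blast
  define L :: "nat gorder"
    where "L = \<lparr>carrier = {0..<card down_sets}, eq = (=), le = (\<lambda>i j. g i \<subseteq> g j)\<rparr>"
  have L: "bij_betw g (carrier L) down_sets" "eq L = (=)" "\<And>i j. le L i j \<longleftrightarrow> g i \<subseteq> g j"
    using g by (simp_all add: L_def)
  then have dist: "distributive_lattice L"
    by (intro distributive_lattice_of_sets[of g L down_sets]) (auto simp: down_sets_def)
  have g_down: "g i \<in> down_sets" if "i \<in> carrier L" for i
    using L(1) that by (auto simp: bij_betw_def)
  define \<phi> :: "nat \<Rightarrow> ('a, 'k) toric_poly"
    where "\<phi> i = Var T * (\<Prod>x\<in>maximals (g i). Var (X x))" for i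
  have \<phi>: "\<phi> i = Poly_Mapping.single (antichain_exponent (maximals (g i))) 1" for i
    by (simp add: \<phi>_def antichain_monomial)
  have standard: "standard_monomial \<phi> = (\<lambda>is. Poly_Mapping.single (exponent (map g is)) 1)"
    by (rule ext) (simp add: standard_monomial_def ext[OF \<phi>] prod_list_single exponent_def o_def)
  have multichains_L: "is \<in> multichains L \<longleftrightarrow>
      set is \<subseteq> carrier L \<and> sorted_wrt (\<subseteq>) (map g is)" for "is"
    by (simp add: multichains_def L(3) sorted_wrt_map)
  \<comment> \<open>Multichains of \<open>L\<close> name exactly the increasing lists of down-sets,
    so existence and uniqueness of decompositions carry over to them.\<close>
  have map_g: "map g ` multichains L = {Is. set Is \<subseteq> down_sets \<and> sorted_wrt (\<subseteq>) Is}"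
  proof (intro subset_antisym subsetI)
    fix Is
    assume Is: "Is \<in> {Is. set Is \<subseteq> down_sets \<and> sorted_wrt (\<subseteq>) Is}"
    then have "Is \<in> lists (g ` carrier L)"
      using L(1) by (auto simp: bij_betw_def)
    then obtain "is" where "Is = map g is" "set is \<subseteq> carrier L"
      by (auto simp: lists_image)
    then show "Is \<in> map g ` multichains L"
      using Is by (intro image_eqI[of _ _ "is"]) (simp_all add: multichains_L)
  qed (auto simp: multichains_L subset_iff g_down)
  have inj: "inj_on (\<lambda>is. exponent (map g is)) (multichains L)"
  proof (rule inj_onI)
    fix "is" js
    assume m: "is \<in> multichains L" "js \<in> multichains L"
      and "exponent (map g is) = exponent (map g js)"
    then have "map g is = map g js"
      by (intro exponent_inject) (auto simp: multichains_L subset_iff g_down)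
    moreover have "inj_on g (set is \<union> set js)"
      using m L(1) by (auto simp: multichains_L bij_betw_def intro: inj_on_subset)
    ultimately show "is = js"
      by (simp add: inj_on_map_eq_map)
  qed
  have monomials: "standard_monomial \<phi> ` multichains L = (\<lambda>m. Poly_Mapping.single m 1) ` cone"
    unfolding standard exponent_image[symmetric] map_g[symmetric] by (simp add: image_image)
  interpret graded_algebra poly_scale "toric_ring P :: ('a, 'k) toric_poly set" "toric_component P"
    by (rule graded_algebra_toric_ring)
  interpret L: distributive_lattice L
    by (rule dist)
  have "algebra_with_straightening_laws poly_scale (toric_ring P) (toric_component P) L \<phi>"
  proof (unfold_locales, goal_cases)
    case 1
    show ?case
    proof (rule inj_onI)
      fix i j
      assume ij: "i \<in> carrier L" "j \<in> carrier L" "\<phi> i = \<phi> j"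
      \<comment> \<open>Viewing \<open>i\<close> and \<open>j\<close> as one-element multichains
        reduces injectivity of \<open>\<phi>\<close> to \<open>inj\<close>.\<close>
      then have "exponent (map g [i]) = exponent (map g [j])"
        by (simp add: exponent_def \<phi>)
      moreover have "[i] \<in> multichains L" "[j] \<in> multichains L"
        using ij by (simp_all add: multichains_L)
      ultimately have "[i] = [j]"
        by (rule inj_onD[OF inj])
      then show "i = j"
        by simp
    qed
  next
    case (2 i)
    then have "\<phi> i \<in> toric_component P 1"
      by (simp add: toric_component_def toric_ring_eq \<phi> antichain_exponent_in_cone
          maximals_antichain g_down)
    then show ?case
      by blast
  next
    case 3
    show ?case
      unfolding standard using inj by (simp add: inj_on_def)
  next
    case 4
    show ?case
      unfolding monomials by (rule independent_monomials)
  next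
    case 5
    show ?case
      unfolding monomials span_monomials toric_ring_eq ..
  next
    case (6 i j C r \<gamma>)
    \<comment> \<open>The product is a single monomial, so every \<open>\<gamma>\<close> in
      \<open>C\<close> must have its exponent.\<close>
    have "\<phi> i * \<phi> j = Poly_Mapping.single (exponent [g i, g j]) 1"
      by (simp add: \<phi> mult_single exponent_def)
    then have eq: "exponent (map g \<gamma>) = exponent [g i, g j]"
      using 6 inj_on_subset[OF inj, of C]
      by (intro monomial_combination_eq_monomial[of C "\<lambda>is. exponent (map g is)" r])
        (auto simp: standard)
    \<comment> \<open>The exponent of \<open>T\<close> counts entries, so \<open>\<gamma>\<close>
      has exactly two and in particular a head.\<close>
    then have "length \<gamma> = length [g i, g j]"
      by (metis exponent_T length_map)
    then obtain h k where \<gamma>: "\<gamma> = [h, k]"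
      by (auto simp: length_Suc_conv numeral_2_eq_2)
    have "\<gamma> \<in> multichains L"
      using 6 by blast
    then have hk: "h \<in> carrier L" "k \<in> carrier L" "g h \<subseteq> g k"
      by (auto simp: multichains_L \<gamma>)
    \<comment> \<open>Swapping the factors yields the inclusion in \<open>g j\<close> from the same
      lemma as the one in \<open>g i\<close>.\<close>
    have "exponent [g i, g j] = exponent [g j, g i]"
      by (simp add: exponent_def add.commute)
    then have "g h \<subseteq> g i" "g h \<subseteq> g j"
      using exponent_pair_subset[of "g h" "g k" "g i" "g j"]
        exponent_pair_subset[of "g h" "g k" "g j" "g i"] eq 6 hk g_down
      by (auto simp: \<gamma>)
    then show ?case
      by (simp add: \<gamma> L(3))
  qed
  then show ?thesis
    using dist by (intro exI[of _ L] exI[of _ \<phi>]) (simp add: L_def)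
qed

end
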